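(* Let $E$ be a real linear space, $\psi:E\to\mathbb{R}$ a seminorm, $K, A\subseteq E$ nontrivial cones with normlike-bases $B_K$ and $B_A$ (with respect to $\psi$), and let $K$ be pointed. Define $S_{-K}:=\mathrm{conv}(-B_K)$ and $S_A^0:=\mathrm{conv}(B_A\cup\{0\})$. If there exists $(x',\alpha)\in K^{a\#}$ such that $$x'(a)+\alpha\psi(a)\ \geq\ 0\ >\ x'(k)+\alpha\psi(k)\quad\text{for all } a\in A\text{ and }k\in -K\setminus\{0\},$$ then $S_A^0\cap S_{-K}=\emptyset$.
   Context: $E\neq\{0\}$ is a real linear space with algebraic dual $E'$; $\mathbb{R}_+=[0,\infty)$. A set $K\subseteq E$ is a cone if $0\in K=\mathbb{R}_+\cdot K$ (not necessarily convex); it is nontrivial if $\{0\}\neq K\neq E$, pointed if $K\cap(-K)=\{0\}$. A seminorm is a sublinear symmetric function $\psi:E\to\mathbb{R}$. A nontrivial cone $K$ has a normlike-base (w.r.t. $\psi$) if $\psi(x)>0$ for all $x\in K\setminus\{0\}$; the normlike-base is then $B_K:=\{x\in K\mid \psi(x)=1\}$. All normlike-bases are taken with respect to the same fixed seminorm $\psi$. $\mathrm{conv}$ is the convex hull; $-K\setminus\{0\}$ means $(-K)\setminus\{0\}$. $K^\#:=\{y'\in E'\mid \forall k\in K\setminus\{0\}:\ y'(k)>0\}$ and $K^{a\#}:=\{(x',\alpha)\in K^\#\times\mathbb{R}_+\mid \forall y\in K\setminus\{0\}:\ x'(y)-\alpha\psi(y)>0\}$. *)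

theory Defs
  imports "HOL-Analysis.Convex"
begin

definition seminorm :: "('a::real_vector \<Rightarrow> real) \<Rightarrow> bool" where
  "seminorm \<psi> \<longleftrightarrow>
     (\<forall>x y. \<psi> (x + y) \<le> \<psi> x + \<psi> y) \<and>
     (\<forall>c x. c \<ge> 0 \<longrightarrow> \<psi> (c *\<^sub>R x) = c * \<psi> x) \<and>
     (\<forall>x. \<psi> (- x) = \<psi> x)"

(* Unlike the library's cone, which admits the empty set. *)
definition zero_cone :: "'a::real_vector set \<Rightarrow> bool" where
  "zero_cone K \<longleftrightarrow> 0 \<in> K \<and> K = {c *\<^sub>R x | c x. c \<ge> 0 \<and> x \<in> K}"

lemma zero_cone_iff_cone: "zero_cone K \<longleftrightarrow> cone K \<and> K \<noteq> {}"
proof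
  assume "zero_cone K"
  then show "cone K \<and> K \<noteq> {}"
    unfolding zero_cone_def cone_def by blast
next
  assume K: "cone K \<and> K \<noteq> {}"
  then have "0 \<in> K"
    using cone_contains_0 by blast
  moreover have "K = {c *\<^sub>R x | c x. c \<ge> 0 \<and> x \<in> K}"
  proof
    show "K \<subseteq> {c *\<^sub>R x | c x. c \<ge> 0 \<and> x \<in> K}"
    proof
      fix x assume "x \<in> K"
      then have "x = 1 *\<^sub>R x \<and> (1::real) \<ge> 0 \<and> x \<in> K"
        by simp
      then show "x \<in> {c *\<^sub>R x | c x. c \<ge> 0 \<and> x \<in> K}"
        by blast
    qed
    show "{c *\<^sub>R x | c x. c \<ge> 0 \<and> x \<in> K} \<subseteq> K"
      using K unfolding cone_def by blast
  qed
  ultimately show "zero_cone K"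
    unfolding zero_cone_def by blast
qed

definition nontrivial_cone :: "'a::real_vector set \<Rightarrow> bool" where
  "nontrivial_cone K \<longleftrightarrow> zero_cone K \<and> K \<noteq> {0} \<and> K \<noteq> UNIV"

definition pointed :: "'a::real_vector set \<Rightarrow> bool" where
  "pointed K \<longleftrightarrow> K \<inter> uminus ` K = {0}"

definition has_normlike_base :: "('a::real_vector \<Rightarrow> real) \<Rightarrow> 'a set \<Rightarrow> bool" where
  "has_normlike_base \<psi> K \<longleftrightarrow> (\<forall>x\<in>K - {0}. \<psi> x > 0)"

definition normlike_base :: "('a::real_vector \<Rightarrow> real) \<Rightarrow> 'a set \<Rightarrow> 'a set" where
  "normlike_base \<psi> K = {x \<in> K. \<psi> x = 1}"

(* The algebraic dual is the set of all linear real-valued functions. *)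
definition dual_sharp :: "'a::real_vector set \<Rightarrow> ('a \<Rightarrow> real) set" where
  "dual_sharp K = {y'. linear y' \<and> (\<forall>k\<in>K - {0}. y' k > 0)}"

definition aug_dual_sharp ::
    "('a::real_vector \<Rightarrow> real) \<Rightarrow> 'a set \<Rightarrow> (('a \<Rightarrow> real) \<times> real) set" where
  "aug_dual_sharp \<psi> K =
     {(x', \<alpha>) \<in> dual_sharp K \<times> {0..}. \<forall>y\<in>K - {0}. x' y - \<alpha> * \<psi> y > 0}"

end

theory Submission
  imports Defs
begin

text \<open>On \<open>\<psi> = 1\<close> the hypothesis says \<open>x' \<ge> -\<alpha>\<close> on the base of \<open>A\<close> and \<open>x' < -\<alpha>\<close> on the
  negated base of \<open>K\<close>. Since \<open>\<alpha> \<ge> 0\<close>, the first half-space also contains \<open>0\<close>; both half-spaces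
  are convex, hence contain the respective convex hulls, and they are disjoint.\<close>

theorem theorem5p11:
  fixes \<psi> :: "'a::real_vector \<Rightarrow> real" and K A :: "'a set"
  assumes "(UNIV :: 'a set) \<noteq> {0}"
    and "seminorm \<psi>"
    and "nontrivial_cone K" and "has_normlike_base \<psi> K"
    and "nontrivial_cone A" and "has_normlike_base \<psi> A"
    and "pointed K"
    and "\<exists>(x', \<alpha>)\<in>aug_dual_sharp \<psi> K.
           \<forall>a\<in>A. \<forall>k\<in>uminus ` K - {0}.
             x' a + \<alpha> * \<psi> a \<ge> 0 \<and> 0 > x' k + \<alpha> * \<psi> k"
  shows "(convex hull (normlike_base \<psi> A \<union> {0})) \<inter>
         (convex hull (uminus ` normlike_base \<psi> K)) = {}"
proof -
  obtain x' \<alpha> where "(x', \<alpha>) \<in> aug_dual_sharp \<psi> K"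
    and sep: "\<And>a k. a \<in> A \<Longrightarrow> k \<in> uminus ` K - {0} \<Longrightarrow>
      x' a + \<alpha> * \<psi> a \<ge> 0 \<and> 0 > x' k + \<alpha> * \<psi> k"
    using assms(8) by blast
  then have lin: "linear x'" and \<alpha>: "\<alpha> \<ge> 0"
    by (auto simp: aug_dual_sharp_def dual_sharp_def)
  have zero: "0 \<in> A" "0 \<in> K" and "K \<noteq> {0}"
    using assms(3,5) by (auto simp: nontrivial_cone_def zero_cone_def)
  \<comment> \<open>\<open>sep\<close> yields its two inequalities only for a pair \<open>a\<close>,
    \<open>k\<close>, so the bound on \<open>A\<close> needs some nonzero point of
    \<open>-K\<close>; \<open>K \<noteq> {0}\<close> supplies one.\<close>
  then obtain k where k: "k \<in> uminus ` K - {0}"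
    by force
  \<comment> \<open>This keeps \<open>0\<close> out of the base of \<open>K\<close>: a point with
    \<open>\<psi> y = 1\<close> is nonzero, so \<open>sep\<close> applies to
    \<open>- y\<close>.\<close>
  have "\<psi> 0 = 0"
    using assms(2) unfolding seminorm_def by (metis mult_zero_left order_refl scaleR_zero_left)
  have "convex hull (normlike_base \<psi> A \<union> {0}) \<subseteq> x' -` {- \<alpha>..}"
  proof (rule hull_minimal)
    show "normlike_base \<psi> A \<union> {0} \<subseteq> x' -` {- \<alpha>..}"
      using sep[OF _ k] \<alpha> linear_0[OF lin] by (force simp: normlike_base_def)
  qed (intro convex_linear_vimage lin convex_real_interval)
  moreover have "convex hull (uminus ` normlike_base \<psi> K) \<subseteq> x' -` {..<- \<alpha>}"
  proof (rule hull_minimal)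
    show "uminus ` normlike_base \<psi> K \<subseteq> x' -` {..<- \<alpha>}"
    proof (intro image_subsetI)
      fix y assume "y \<in> normlike_base \<psi> K"
      then have "- y \<in> uminus ` K - {0}" "\<psi> (- y) = 1"
        using assms(2) \<open>\<psi> 0 = 0\<close> by (auto simp: normlike_base_def seminorm_def)
      then show "- y \<in> x' -` {..<- \<alpha>}"
        \<comment> \<open>Here \<open>0 \<in> A\<close> serves as the partner \<open>a\<close> that
          \<open>sep\<close> requires.\<close>
        using sep[OF zero(1)] by fastforce
    qed
  qed (intro convex_linear_vimage lin convex_real_interval)
  ultimately show ?thesis
    by fastforce
qed

end
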